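(* Suppose that the function $g\in BB(\mathbb{R})$ is continuous at every point of the open bounded interval $(a,b)$. Define the function $G:(a,b)\to\mathbb{R}$ by $G(t)=\int_{\mathbb{R}}g\chi_{(a,t)}$ for each $t\in(a,b)$. Then $G$ is differentiable and satisfies $$G'(t)=g(t)\quad\text{for every }t\in(a,b).$$ Furthermore $$\lim_{t\nearrow b}G(t)=\int_{\mathbb{R}}g\chi_{(a,b)}\qquad\text{and}\qquad\lim_{t\searrow a}G(t)=0 .$$
   Context: For an integer $k\ge 0$, $D_{k}(\mathbb{R})$ is the collection of all semiclosed dyadic intervals $[n2^{-k},(n+1)2^{-k})$ with $n\in\mathbb{Z}$. $BB(\mathbb{R})$ is the set of bounded functions $f:\mathbb{R}\to\mathbb{R}$ which vanish outside some bounded set. For $f\in BB(\mathbb{R})$ set $U_{k}(f)=2^{-k}\sum_{I\in D_{k}(\mathbb{R})}\sup_{p\in I}f(p)$ and $L_{k}(f)=2^{-k}\sum_{I\in D_{k}(\mathbb{R})}\inf_{p\in I}f(p)$ (only finitely many terms are non-zero). The sequences $U_k(f)$ and $L_k(f)$ are bounded and, respectively, non-increasing and non-decreasing in $k$, so they converge. A function $f\in BB(\mathbb{R})$ is (dyadically) Riemann integrable, written $f\in RI(\mathbb{R})$, if $\lim_{k\to\infty}U_{k}(f)=\lim_{k\to\infty}L_{k}(f)$; the common value is denoted $\int_{\mathbb{R}}f$. Writing $\int_{\mathbb{R}}f$ includes the assertion that $f\in RI(\mathbb{R})$. $\chi_{E}$ denotes the characteristic (indicator) function of $E$. *)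

theory Defs
  imports "HOL-Analysis.Analysis"
begin

definition dyadic_intervals :: "nat \<Rightarrow> real set set" where
  "dyadic_intervals k = {{real_of_int n / 2 ^ k ..< (real_of_int n + 1) / 2 ^ k} | n. True}"

definition BB :: "(real \<Rightarrow> real) set" where
  "BB = {f. bounded (range f) \<and> (\<exists>S. bounded S \<and> (\<forall>x. x \<notin> S \<longrightarrow> f x = 0))}"

(* For f in BB only finitely many terms of the following two sums are non-zero,
   so infsum is then an ordinary finite sum. *)

definition dyadic_upper :: "nat \<Rightarrow> (real \<Rightarrow> real) \<Rightarrow> real" where
  "dyadic_upper k f = (1 / 2 ^ k) * (\<Sum>\<^sub>\<infinity>I\<in>dyadic_intervals k. SUP p\<in>I. f p)"

definition dyadic_lower :: "nat \<Rightarrow> (real \<Rightarrow> real) \<Rightarrow> real" where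
  "dyadic_lower k f = (1 / 2 ^ k) * (\<Sum>\<^sub>\<infinity>I\<in>dyadic_intervals k. INF p\<in>I. f p)"

definition RI :: "(real \<Rightarrow> real) set" where
  "RI = {f \<in> BB. \<exists>l. (\<lambda>k. dyadic_upper k f) \<longlonglongrightarrow> l \<and> (\<lambda>k. dyadic_lower k f) \<longlonglongrightarrow> l}"

(* Meaningful for f in RI, where it is also the limit of the lower sums. *)
definition dyadic_integral :: "(real \<Rightarrow> real) \<Rightarrow> real" where
  "dyadic_integral f = lim (\<lambda>k. dyadic_upper k f)"

end

theory Submission
  imports Defs
begin

text \<open>
  The upper sum of \<open>f\<close> at level \<open>k\<close> is the Lebesgue integral of a step
  function: the function whose value at \<open>x\<close> is the supremum of \<open>f\<close> over the dyadic interval of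
  length \<open>1 / 2 ^ k\<close> around \<open>x\<close>. As \<open>k\<close> grows these intervals shrink to \<open>x\<close>, so the step functions
  converge to \<open>f\<close> at every point of continuity, and for \<open>f \<in> BB\<close> they are all dominated by one multiple
  of the indicator of a bounded interval. If \<open>f\<close> is measurable and continuous almost everywhere,
  dominated convergence therefore gives convergence of the upper sums to the Lebesgue integral of \<open>f\<close>.
  Lower sums are negated upper sums of \<open>- f\<close>, so they have the same limit, and
  \<open>f \<in> RI\<close> with \<open>dyadic_integral f\<close> equal to the ordinary integral
  (\<open>RI_and_dyadic_integral_eq\<close>).

  Cutting \<open>g\<close> off outside \<open>{a<..<t}\<close> creates discontinuities at most at \<open>a\<close> and \<open>t\<close>, so this applies
  to all the functions in the theorem. With \<open>h\<close> the cut-off of \<open>g\<close> to \<open>{a<..<b}\<close>, it identifies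
  \<open>G t\<close> with the indefinite Henstock--Kurzweil integral \<open>H t\<close> of \<open>h\<close> over \<open>{a..t}\<close>. The function \<open>H\<close>
  is defined on all of \<open>{a..b}\<close>; it is continuous there, which yields both one-sided limits
  (\<open>H b\<close> is the integral of \<open>h\<close>, and \<open>H a = 0\<close>), and
  its derivative at every point \<open>t\<close> where \<open>h\<close> is continuous is \<open>h t\<close>.
\<close>

section \<open>Dyadic cells and the upper step function\<close>

definition dyadic_cell :: "nat \<Rightarrow> int \<Rightarrow> real set" where
  "dyadic_cell k n = {real_of_int n / 2 ^ k ..< (real_of_int n + 1) / 2 ^ k}"

text \<open>
  The index \<open>\<lfloor>x * 2 ^ k\<rfloor>\<close> is the one of the level-\<open>k\<close> cell containing \<open>x\<close>.
\<close>
definition upper_step :: "nat \<Rightarrow> (real \<Rightarrow> real) \<Rightarrow> real \<Rightarrow> real" where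
  "upper_step k f x = (SUP p\<in>dyadic_cell k \<lfloor>x * 2 ^ k\<rfloor>. f p)"

lemma mem_dyadic_cell_iff: "x \<in> dyadic_cell k n \<longleftrightarrow> \<lfloor>x * 2 ^ k\<rfloor> = n"
  unfolding dyadic_cell_def floor_eq_iff by (auto simp: field_simps)

lemma dyadic_cell_nonempty: "dyadic_cell k n \<noteq> {}"
proof -
  have "real_of_int n / 2 ^ k \<in> dyadic_cell k n"
    unfolding mem_dyadic_cell_iff by simp
  then show ?thesis by blast
qed

lemma inj_dyadic_cell: "inj (dyadic_cell k)"
proof (rule injI)
  fix m n assume "dyadic_cell k m = dyadic_cell k n"
  then show "m = n"
    using dyadic_cell_nonempty[of k m] mem_dyadic_cell_iff[of _ k m] mem_dyadic_cell_iff[of _ k n]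
    by auto
qed

lemma dyadic_intervals_eq: "dyadic_intervals k = range (dyadic_cell k)"
  by (auto simp: dyadic_intervals_def dyadic_cell_def)

lemma measure_dyadic_cell: "measure lborel (dyadic_cell k n) = 1 / 2 ^ k"
proof -
  have "real_of_int n / 2 ^ k \<le> (real_of_int n + 1) / 2 ^ k"
    by (simp add: divide_right_mono)
  then show ?thesis
    by (simp add: dyadic_cell_def field_simps)
qed

lemma dist_in_dyadic_cell:
  assumes "x \<in> dyadic_cell k n" "y \<in> dyadic_cell k n"
  shows "\<bar>x - y\<bar> < (1 / 2) ^ k"
proof -
  have "(real_of_int n + 1) / 2 ^ k = real_of_int n / 2 ^ k + (1 / 2) ^ k"
    by (simp add: field_simps power_divide)
  with assms show ?thesis unfolding dyadic_cell_def by auto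
qed

text \<open>
  Taking the support inside an interval with integer endpoints ensures that at every level each
  dyadic cell lies either inside that interval or outside it.
\<close>
lemma BB_bounds:
  assumes "f \<in> BB"
  obtains M N :: nat where "\<And>x. \<bar>f x\<bar> \<le> real M" "\<And>x. x \<notin> {- real N ..< real N} \<Longrightarrow> f x = 0"
proof -
  from assms obtain S C where C: "\<And>x. \<bar>f x\<bar> \<le> C" and S: "bounded S" "\<And>x. x \<notin> S \<Longrightarrow> f x = 0"
    unfolding BB_def bounded_iff by auto
  from S(1) obtain B where B: "\<And>x. x \<in> S \<Longrightarrow> \<bar>x\<bar> \<le> B"
    unfolding bounded_iff by auto
  obtain M where M: "C \<le> real M" using real_arch_simple by blast
  obtain N where N: "B < real N" using reals_Archimedean2 by blast
  show ?thesis
  proof (rule that)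
    show "\<bar>f x\<bar> \<le> real M" for x using C[of x] M by linarith
    show "f x = 0" if "x \<notin> {- real N ..< real N}" for x
    proof (rule S(2))
      show "x \<notin> S" using B[of x] N that by auto
    qed
  qed
qed

lemma abs_SUP_le:
  fixes f :: "'a \<Rightarrow> real"
  assumes "A \<noteq> {}" "\<And>x. x \<in> A \<Longrightarrow> \<bar>f x - c\<bar> \<le> e"
  shows "\<bar>(SUP x\<in>A. f x) - c\<bar> \<le> e"
proof -
  obtain x where x: "x \<in> A" using assms(1) by blast
  have b: "bdd_above (f ` A)"
    by (rule bdd_aboveI2[of _ _ "c + e"]) (use assms(2) in \<open>force simp: abs_le_iff\<close>)
  have "(SUP x\<in>A. f x) \<le> c + e"
    by (rule cSUP_least) (use assms in \<open>force simp: abs_le_iff\<close>)+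
  moreover have "f x \<le> (SUP x\<in>A. f x)"
    using x b by (rule cSUP_upper)
  ultimately show ?thesis using assms(2)[OF x] by linarith
qed

text \<open>
  The cell around \<open>x\<close> has length \<open>(1 / 2) ^ k\<close>, so eventually all values of \<open>f\<close> on it, hence also their
  supremum, are close to \<open>f x\<close>.
\<close>
lemma upper_step_tendsto:
  assumes "isCont f x"
  shows "(\<lambda>k. upper_step k f x) \<longlonglongrightarrow> f x"
proof (rule LIMSEQ_I)
  fix e :: real assume "e > 0"
  then obtain d where d: "d > 0" "\<And>y. \<bar>y - x\<bar> < d \<Longrightarrow> \<bar>f y - f x\<bar> < e / 2"
    using assms half_gt_zero[of e] unfolding continuous_at_eps_delta dist_real_def by metis
  obtain K where K: "(1 / 2 :: real) ^ K < d"
    using real_arch_pow_inv[OF d(1), of "1 / 2"] by auto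
  have "norm (upper_step k f x - f x) < e" if "k \<ge> K" for k
  proof -
    have small: "(1 / 2 :: real) ^ k < d"
      using power_decreasing[OF that, of "1 / 2 :: real"] K by linarith
    have "\<bar>(SUP p\<in>dyadic_cell k \<lfloor>x * 2 ^ k\<rfloor>. f p) - f x\<bar> \<le> e / 2"
    proof (rule abs_SUP_le[OF dyadic_cell_nonempty])
      fix p assume "p \<in> dyadic_cell k \<lfloor>x * 2 ^ k\<rfloor>"
      then have "\<bar>p - x\<bar> < (1 / 2) ^ k"
        by (rule dist_in_dyadic_cell) (simp add: mem_dyadic_cell_iff)
      with d(2)[of p] small show "\<bar>f p - f x\<bar> \<le> e / 2" by linarith
    qed
    with \<open>e > 0\<close> show ?thesis by (simp add: upper_step_def)
  qed
  then show "\<exists>K. \<forall>k\<ge>K. norm (upper_step k f x - f x) < e" by blast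
qed

lemma floor_mem_dyadic_range_iff:
  "\<lfloor>x * 2 ^ k\<rfloor> \<in> {- int N * 2 ^ k ..< int N * 2 ^ k} \<longleftrightarrow> x \<in> {- real N ..< real N}"
  for x :: real
proof -
  have "- int N * 2 ^ k \<le> \<lfloor>x * 2 ^ k\<rfloor> \<longleftrightarrow> - real N * 2 ^ k \<le> x * 2 ^ k"
    by (simp add: le_floor_iff)
  moreover have "\<lfloor>x * 2 ^ k\<rfloor> < int N * 2 ^ k \<longleftrightarrow> x * 2 ^ k < real N * 2 ^ k"
    by (simp add: floor_less_iff)
  ultimately show ?thesis
    by (simp only: atLeastLessThan_iff mult_le_cancel_right_pos mult_less_cancel_right_pos
        zero_less_power zero_less_numeral)
qed

text \<open>
  This makes the sum over all dyadic intervals a finite one.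
\<close>
lemma SUP_dyadic_cell_eq_0:
  assumes supp: "\<And>x. x \<notin> {- real N ..< real N} \<Longrightarrow> f x = 0"
    and n: "n \<notin> {- int N * 2 ^ k ..< int N * 2 ^ k}"
  shows "(SUP p\<in>dyadic_cell k n. f p) = (0 :: real)"
proof -
  have "f p = 0" if "p \<in> dyadic_cell k n" for p
    using that n by (intro supp) (simp only: mem_dyadic_cell_iff not_False_eq_True flip: floor_mem_dyadic_range_iff[of p k N])
  then have "f ` dyadic_cell k n = {0}"
    using dyadic_cell_nonempty[of k n] by force
  then show ?thesis by simp
qed

lemma upper_step_eq_sum:
  assumes supp: "\<And>x. x \<notin> {- real N ..< real N} \<Longrightarrow> f x = 0"
  shows "upper_step k f x = (\<Sum>n\<in>{- int N * 2 ^ k ..< int N * 2 ^ k}.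
           (SUP p\<in>dyadic_cell k n. f p) * indicator (dyadic_cell k n) x)"
proof -
  let ?F = "{- int N * 2 ^ k ..< int N * 2 ^ k}"
  have "(\<Sum>n\<in>?F. (SUP p\<in>dyadic_cell k n. f p) * indicator (dyadic_cell k n) x)
      = (\<Sum>n\<in>?F. if n = \<lfloor>x * 2 ^ k\<rfloor> then (SUP p\<in>dyadic_cell k n. f p) else 0)"
    by (rule sum.cong) (auto simp: indicator_def mem_dyadic_cell_iff)
  also have "\<dots> = (if \<lfloor>x * 2 ^ k\<rfloor> \<in> ?F then upper_step k f x else 0)"
    by (simp add: upper_step_def)
  also have "\<dots> = upper_step k f x"
    using SUP_dyadic_cell_eq_0[OF supp, where n = "\<lfloor>x * 2 ^ k\<rfloor>" and k = k]
    by (simp add: upper_step_def)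
  finally show ?thesis by simp
qed

section \<open>Dyadic sums and the Lebesgue integral\<close>

lemma dyadic_upper_eq_integral:
  assumes "f \<in> BB"
  shows "upper_step k f \<in> borel_measurable lborel"
    and "dyadic_upper k f = integral\<^sup>L lborel (upper_step k f)"
proof -
  obtain M N :: nat where supp: "\<And>x. x \<notin> {- real N ..< real N} \<Longrightarrow> f x = 0"
    using BB_bounds[OF assms] by metis
  let ?F = "{- int N * 2 ^ k ..< int N * 2 ^ k}"
  let ?c = "\<lambda>n. SUP p\<in>dyadic_cell k n. f p"
  have step: "upper_step k f = (\<lambda>x. \<Sum>n\<in>?F. ?c n * indicator (dyadic_cell k n) x)"
    by (rule ext) (rule upper_step_eq_sum[OF supp])
  have [measurable]: "dyadic_cell k n \<in> sets borel" for n
    by (simp add: dyadic_cell_def)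
  show "upper_step k f \<in> borel_measurable lborel"
    unfolding step by measurable
  have int: "integrable lborel (\<lambda>x. indicator (dyadic_cell k n) x :: real)" for n
    by (rule integrable_real_indicator) (auto simp: dyadic_cell_def intro!: emeasure_bounded_finite[simplified])
  have "integral\<^sup>L lborel (upper_step k f) = (\<Sum>n\<in>?F. ?c n * (1 / 2 ^ k))"
    unfolding step by (subst Bochner_Integration.integral_sum) (simp_all add: int measure_dyadic_cell)
  moreover have "(\<Sum>\<^sub>\<infinity>I\<in>dyadic_intervals k. SUP p\<in>I. f p) = (\<Sum>n\<in>?F. ?c n)"
  proof -
    have "(\<Sum>\<^sub>\<infinity>I\<in>dyadic_intervals k. SUP p\<in>I. f p) = (\<Sum>\<^sub>\<infinity>n. ?c n)"
      unfolding dyadic_intervals_eq by (subst infsum_reindex[OF inj_dyadic_cell]) (simp add: o_def)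
    also have "\<dots> = (\<Sum>\<^sub>\<infinity>n\<in>?F. ?c n)"
      by (rule infsum_cong_neutral) (auto intro!: SUP_dyadic_cell_eq_0[OF supp])
    finally show ?thesis by simp
  qed
  ultimately show "dyadic_upper k f = integral\<^sup>L lborel (upper_step k f)"
    by (simp add: dyadic_upper_def sum_distrib_left mult.commute sum_divide_distrib)
qed

text \<open>
  Dominated convergence, with a multiple of the indicator of an interval containing the support
  as the majorant.
\<close>
lemma dyadic_upper_tendsto_integral:
  assumes f: "f \<in> BB" and meas: "f \<in> borel_measurable lborel" and cont: "AE x in lborel. isCont f x"
  shows "integrable lborel f" "(\<lambda>k. dyadic_upper k f) \<longlonglongrightarrow> integral\<^sup>L lborel f"
proof -
  obtain M N :: nat where bnd: "\<And>x. \<bar>f x\<bar> \<le> real M"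
    and supp: "\<And>x. x \<notin> {- real N ..< real N} \<Longrightarrow> f x = 0"
    using BB_bounds[OF f] by metis
  let ?w = "\<lambda>x. real M * indicator {- real N ..< real N} x"
  have w: "integrable lborel ?w"
    by (intro integrable_mult_right integrable_real_indicator) auto
  have dom: "norm (upper_step k f x) \<le> ?w x" for k x
  proof (cases "x \<in> {- real N ..< real N}")
    case True
    have "\<bar>upper_step k f x - 0\<bar> \<le> real M"
      unfolding upper_step_def by (rule abs_SUP_le[OF dyadic_cell_nonempty]) (simp add: bnd)
    with True show ?thesis by simp
  next
    case False
    then have "\<lfloor>x * 2 ^ k\<rfloor> \<notin> {- int N * 2 ^ k ..< int N * 2 ^ k}"
      by (simp only: floor_mem_dyadic_range_iff not_False_eq_True)
    then have "upper_step k f x = 0"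
      unfolding upper_step_def by (intro SUP_dyadic_cell_eq_0[OF supp])
    then show ?thesis by simp
  qed
  have lim: "AE x in lborel. (\<lambda>k. upper_step k f x) \<longlonglongrightarrow> f x"
    using cont by eventually_elim (rule upper_step_tendsto)
  show "integrable lborel f"
    by (rule integrable_dominated_convergence[OF meas dyadic_upper_eq_integral(1)[OF f] w lim])
       (intro AE_I2 dom)
  show "(\<lambda>k. dyadic_upper k f) \<longlonglongrightarrow> integral\<^sup>L lborel f"
    unfolding dyadic_upper_eq_integral(2)[OF f]
    by (rule integral_dominated_convergence[OF meas dyadic_upper_eq_integral(1)[OF f] w lim])
       (intro AE_I2 dom)
qed

text \<open>
  Reflection transfers everything known about upper sums to lower sums.
\<close>
lemma dyadic_lower_eq_upper: "dyadic_lower k f = - dyadic_upper k (\<lambda>x. - f x)"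
proof -
  have "(INF p\<in>I. f p) = - (SUP p\<in>I. - f p)" for I
    by (simp add: Inf_real_def image_image)
  then show ?thesis
    by (simp add: dyadic_lower_def dyadic_upper_def infsum_uminus)
qed

lemma BB_uminus: "f \<in> BB \<Longrightarrow> (\<lambda>x. - f x) \<in> BB"
  unfolding BB_def by (auto simp: bounded_iff)

lemma RI_and_dyadic_integral_eq:
  assumes f: "f \<in> BB" and meas: "f \<in> borel_measurable lborel" and cont: "AE x in lborel. isCont f x"
  shows "f \<in> RI" "dyadic_integral f = integral UNIV f" "f integrable_on UNIV"
proof -
  note U = dyadic_upper_tendsto_integral[OF assms]
  have "(\<lambda>k. dyadic_upper k (\<lambda>x. - f x)) \<longlonglongrightarrow> integral\<^sup>L lborel (\<lambda>x. - f x)"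
    by (rule dyadic_upper_tendsto_integral(2))
       (use cont in \<open>auto simp: BB_uminus f intro!: borel_measurable_uminus meas[simplified]
          elim!: eventually_mono\<close>)
  from tendsto_minus[OF this] have "(\<lambda>k. dyadic_lower k f) \<longlonglongrightarrow> integral\<^sup>L lborel f"
    by (simp add: dyadic_lower_eq_upper)
  with U(2) f show "f \<in> RI" unfolding RI_def by blast
  show "dyadic_integral f = integral UNIV f"
    using U by (simp add: dyadic_integral_def limI integral_lborel)
  show "f integrable_on UNIV"
    using U(1) by (rule integrable_on_lborel)
qed

section \<open>Cutting off outside an open interval\<close>

text \<open>
  Each point other than the two endpoints has a neighbourhood on which the cut-off function
  is either \<open>g\<close> or \<open>0\<close>.
\<close>
lemma isCont_times_indicator_interval:
  fixes g :: "real \<Rightarrow> real"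
  assumes "\<And>x. x \<in> {c<..<d} \<Longrightarrow> isCont g x" and x: "x \<notin> {c, d}"
  shows "isCont (\<lambda>x. g x * indicator {c<..<d} x) x"
proof (cases "x \<in> {c<..<d}")
  case True
  then have "\<forall>\<^sub>F y in nhds x. y \<in> {c<..<d}"
    by (intro eventually_nhds_in_open) auto
  then have "\<forall>\<^sub>F y in nhds x. g y * indicator {c<..<d} y = g y"
    by eventually_elim simp
  with assms(1)[OF True] show ?thesis by (simp only: isCont_cong continuous_const)
next
  case False
  with x have "x \<in> - {c..d}" by auto
  then have "\<forall>\<^sub>F y in nhds x. y \<in> - {c..d}"
    by (intro eventually_nhds_in_open) auto
  then have "\<forall>\<^sub>F y in nhds x. g y * indicator {c<..<d} y = 0"
    by eventually_elim (auto simp: indicator_def)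
  then show ?thesis by (simp only: isCont_cong continuous_const)
qed

lemma BB_times_indicator:
  assumes "g \<in> BB"
  shows "(\<lambda>x. g x * indicator A x) \<in> BB"
proof -
  from assms obtain C S where *: "\<And>x. \<bar>g x\<bar> \<le> C" "bounded S" "\<And>x. x \<notin> S \<Longrightarrow> g x = 0"
    unfolding BB_def bounded_iff by auto
  have "\<bar>g x * indicator A x\<bar> \<le> C" for x
    using *(1)[of x] by (auto simp: indicator_def)
  with * show ?thesis unfolding BB_def bounded_iff[of "range _"] by auto
qed

lemma times_indicator_interval_RI:
  fixes g :: "real \<Rightarrow> real"
  assumes g: "g \<in> BB" and cont: "\<And>x. x \<in> {c<..<d} \<Longrightarrow> isCont g x"
  defines "h \<equiv> \<lambda>x. g x * indicator {c<..<d} x"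
  shows "h \<in> RI" "dyadic_integral h = integral UNIV h" "h integrable_on UNIV"
proof -
  have 1: "h \<in> BB" unfolding h_def by (rule BB_times_indicator[OF g])
  have "(\<lambda>x. indicator {c<..<d} x *\<^sub>R g x) \<in> borel_measurable borel"
    by (rule borel_measurable_continuous_on_indicator)
       (auto intro!: continuous_at_imp_continuous_on cont)
  then have 2: "h \<in> borel_measurable lborel" by (simp add: h_def mult.commute)
  have "AE x in lborel. x \<noteq> c" "AE x in lborel. x \<noteq> d" by (rule AE_lborel_singleton)+
  then have 3: "AE x in lborel. isCont h x"
    by eventually_elim (auto simp: h_def intro!: isCont_times_indicator_interval cont)
  show "h \<in> RI" "dyadic_integral h = integral UNIV h" "h integrable_on UNIV"
    using RI_and_dyadic_integral_eq[OF 1 2 3] by blast+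
qed

text \<open>
  The cut-offs to \<open>{a<..<t}\<close> for varying \<open>t\<close> are replaced by a single integrand on varying
  intervals, which is the form needed for an indefinite integral. The integrands can differ at \<open>t\<close>,
  where the left one vanishes.
\<close>
lemma integral_times_indicator_interval:
  fixes g :: "real \<Rightarrow> real"
  assumes "t \<le> b"
  shows "integral UNIV (\<lambda>x. g x * indicator {a<..<t} x)
       = integral {a..t} (\<lambda>x. g x * indicator {a<..<b} x)"
proof -
  have "integral UNIV (\<lambda>x. g x * indicator {a<..<t} x)
      = integral UNIV (\<lambda>x. if x \<in> {a..t} then g x * indicator {a<..<b} x else 0)"
    by (rule integral_spike[where S = "{t}"]) (use assms in \<open>auto simp: indicator_def\<close>)
  then show ?thesis by (simp only: integral_restrict_UNIV)
qed

section \<open>The fundamental theorem of calculus\<close>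

theorem theorem5p1:
  fixes g G :: "real \<Rightarrow> real" and a b :: real
  assumes "a < b"
    and "g \<in> BB"
    and "\<forall>t\<in>{a<..<b}. isCont g t"
    and "\<forall>t\<in>{a<..<b}. G t = dyadic_integral (\<lambda>x. g x * indicator {a<..<t} x)"
  shows "(\<forall>t\<in>{a<..<b}. (\<lambda>x. g x * indicator {a<..<t} x) \<in> RI)
    \<and> (\<forall>t\<in>{a<..<b}. (G has_real_derivative g t) (at t))
    \<and> (\<lambda>x. g x * indicator {a<..<b} x) \<in> RI
    \<and> (G \<longlongrightarrow> dyadic_integral (\<lambda>x. g x * indicator {a<..<b} x)) (at_left b)
    \<and> (G \<longlongrightarrow> 0) (at_right a)"
proof -
  define h where "h = (\<lambda>x. g x * indicator {a<..<b} x)"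
  define H where "H = (\<lambda>t. integral {a..t} h)"
  have R: "(\<lambda>x. g x * indicator {a<..<t} x) \<in> RI"
      "dyadic_integral (\<lambda>x. g x * indicator {a<..<t} x) = H t" if "t \<le> b" for t
  proof -
    have cont: "isCont g x" if "x \<in> {a<..<t}" for x
      using assms(3) that \<open>t \<le> b\<close> by auto
    show "(\<lambda>x. g x * indicator {a<..<t} x) \<in> RI"
      using assms(2) cont by (rule times_indicator_interval_RI(1))
    show "dyadic_integral (\<lambda>x. g x * indicator {a<..<t} x) = H t"
      using times_indicator_interval_RI(2)[OF assms(2) cont] integral_times_indicator_interval[OF that]
      by (simp add: H_def h_def)
  qed
  have GH: "G t = H t" if "t \<in> {a<..<b}" for t
    using assms(4) R(2)[of t] that by auto
  have "h integrable_on UNIV"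
    unfolding h_def using assms(2,3) by (intro times_indicator_interval_RI(3)) auto
  then have int: "h integrable_on {a..b}"
    by (rule integrable_on_subinterval) simp
  have deriv: "(G has_real_derivative g t) (at t)" if t: "t \<in> {a<..<b}" for t
  proof -
    have "isCont h t"
      unfolding h_def using assms(3) t by (intro isCont_times_indicator_interval) auto
    then have "continuous (at t within {a..b} - {}) h"
      by (rule continuous_at_imp_continuous_at_within)
    with int t have "(H has_vector_derivative h t) (at t within {a..b} - {})"
      unfolding H_def by (intro integral_has_vector_derivative_continuous_at) auto
    moreover have "at t within {a..b} - {} = at t"
      using t by (simp add: at_within_Icc_at)
    moreover have "h t = g t" using t by (simp add: h_def)
    ultimately have "(H has_real_derivative g t) (at t)"
      by (simp add: has_real_derivative_iff_has_vector_derivative)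
    then show ?thesis
      by (rule has_field_derivative_transform_within_open[where S = "{a<..<b}"]) (use t GH in auto)
  qed
  have contH: "continuous_on {a..b} H"
    unfolding H_def using int by (rule indefinite_integral_continuous_1)
  have "(H \<longlongrightarrow> H b) (at_left b)"
    using continuous_on_Icc_at_leftD[OF contH assms(1)] .
  moreover have "\<forall>\<^sub>F t in at_left b. H t = G t"
    using eventually_at_left_real[OF assms(1)] by eventually_elim (simp add: GH)
  ultimately have left: "(G \<longlongrightarrow> H b) (at_left b)"
    by (rule Lim_transform_eventually)
  have "(H \<longlongrightarrow> H a) (at_right a)"
    using continuous_on_Icc_at_rightD[OF contH assms(1)] .
  moreover have "\<forall>\<^sub>F t in at_right a. H t = G t"
    using eventually_at_right_real[OF assms(1)] by eventually_elim (simp add: GH)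
  moreover have "H a = 0" by (simp add: H_def)
  ultimately have right: "(G \<longlongrightarrow> 0) (at_right a)"
    using Lim_transform_eventually by metis
  show ?thesis
    using R deriv left right by auto
qed

end
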